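(* Let $v$ be a nonzero vector in $V=\mathbb C^X$ and let $g=\max\{i:0\le i\le D,\ E_iv\ne0\}$ be its dual width. Then for every $x\in X$ there exists a vertex $y$ in the support of $v$ such that $\partial(x,y)\ge D-g$.
   Context: Let $\Gamma=(X,R)$ be a finite connected distance-regular graph with path-length distance $\partial$ and diameter $D\ge3$, $Q$-polynomial with respect to the ordering $E_0,\dots,E_D$ of its primitive idempotents (the primitive idempotents of the Bose–Mesner algebra spanned by the distance matrices $A_i$, where $(A_i)_{yz}=1$ if $\partial(y,z)=i$ and $0$ otherwise; $Q$-polynomial means the Krein parameters $q^h_{ij}$, defined by $E_i\circ E_j=|X|^{-1}\sum_hq^h_{ij}E_h$ with $\circ$ the entrywise product, vanish whenever one of $h,i,j$ exceeds the sum of the other two and are nonzero whenever one equals the sum of the other two). The support of $v\in V$ is the set of $y\in X$ such that the $y$-coordinate of $v$ is nonzero. *)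

theory Defs
  imports Complex_Main
begin

text \<open>Graphs on a finite vertex type 'a: X = UNIV, adjacency relation R.
 Matrices indexed by X are functions 'a \<Rightarrow> 'a \<Rightarrow> complex; vectors in V = C^X are 'a \<Rightarrow> complex.\<close>

definition adjrel :: "('a \<Rightarrow> 'a \<Rightarrow> bool) \<Rightarrow> ('a \<times> 'a) set" where
  "adjrel R = {(x, y). R x y}"

definition gdist :: "('a \<Rightarrow> 'a \<Rightarrow> bool) \<Rightarrow> 'a \<Rightarrow> 'a \<Rightarrow> nat" where
  "gdist R x y = (LEAST n. (x, y) \<in> adjrel R ^^ n)"

definition connected_graph :: "('a \<Rightarrow> 'a \<Rightarrow> bool) \<Rightarrow> bool" where
  "connected_graph R = (\<forall>x y. \<exists>n. (x, y) \<in> adjrel R ^^ n)"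

definition diameter :: "('a::finite \<Rightarrow> 'a \<Rightarrow> bool) \<Rightarrow> nat" where
  "diameter R = Max {gdist R x y | x y. True}"

definition distance_regular :: "('a::finite \<Rightarrow> 'a \<Rightarrow> bool) \<Rightarrow> bool" where
  "distance_regular R \<longleftrightarrow>
     (\<forall>x y. R x y \<longleftrightarrow> R y x) \<and> (\<forall>x. \<not> R x x) \<and> connected_graph R \<and>
     (\<forall>x y x' y' i j. gdist R x y = gdist R x' y' \<longrightarrow>
        card {z. gdist R x z = i \<and> gdist R y z = j} =
        card {z. gdist R x' z = i \<and> gdist R y' z = j})"

definition distmat :: "('a \<Rightarrow> 'a \<Rightarrow> bool) \<Rightarrow> nat \<Rightarrow> 'a \<Rightarrow> 'a \<Rightarrow> complex" where
  "distmat R i = (\<lambda>y z. if gdist R y z = i then 1 else 0)"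

definition mat_mult :: "('a::finite \<Rightarrow> 'a \<Rightarrow> complex) \<Rightarrow> ('a \<Rightarrow> 'a \<Rightarrow> complex) \<Rightarrow> 'a \<Rightarrow> 'a \<Rightarrow> complex" where
  "mat_mult M N = (\<lambda>x z. \<Sum>y\<in>UNIV. M x y * N y z)"

definition mat_vec :: "('a::finite \<Rightarrow> 'a \<Rightarrow> complex) \<Rightarrow> ('a \<Rightarrow> complex) \<Rightarrow> 'a \<Rightarrow> complex" where
  "mat_vec M v = (\<lambda>x. \<Sum>y\<in>UNIV. M x y * v y)"

definition id_mat :: "'a \<Rightarrow> 'a \<Rightarrow> complex" where
  "id_mat = (\<lambda>x y. if x = y then 1 else 0)"

definition bose_mesner :: "('a::finite \<Rightarrow> 'a \<Rightarrow> bool) \<Rightarrow> ('a \<Rightarrow> 'a \<Rightarrow> complex) set" where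
  "bose_mesner R = {M. \<exists>c :: nat \<Rightarrow> complex.
      M = (\<lambda>x y. \<Sum>i\<le>diameter R. c i * distmat R i x y)}"

text \<open>E_0, ..., E_D is an ordering of the primitive idempotents of the Bose--Mesner algebra:
  D+1 nonzero, mutually orthogonal idempotents of the algebra summing to the identity
  (these are exactly the primitive idempotents, as the algebra has dimension D+1).\<close>
definition primitive_idempotents ::
  "('a::finite \<Rightarrow> 'a \<Rightarrow> bool) \<Rightarrow> (nat \<Rightarrow> 'a \<Rightarrow> 'a \<Rightarrow> complex) \<Rightarrow> bool" where
  "primitive_idempotents R E \<longleftrightarrow>
     (\<forall>i\<le>diameter R. E i \<in> bose_mesner R) \<and>
     (\<forall>i\<le>diameter R. E i \<noteq> (\<lambda>x y. 0)) \<and>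
     (\<forall>i\<le>diameter R. \<forall>j\<le>diameter R.
        mat_mult (E i) (E j) = (if i = j then E i else (\<lambda>x y. 0))) \<and>
     (\<lambda>x y. \<Sum>i\<le>diameter R. E i x y) = id_mat"

text \<open>Q-polynomial with respect to E_0, ..., E_D, via the Krein parameters q^h_{ij}
  (written q h i j) defined by E_i \<circ> E_j = |X|^{-1} \<Sum>_h q^h_{ij} E_h.\<close>
definition q_polynomial ::
  "('a::finite \<Rightarrow> 'a \<Rightarrow> bool) \<Rightarrow> (nat \<Rightarrow> 'a \<Rightarrow> 'a \<Rightarrow> complex) \<Rightarrow> bool" where
  "q_polynomial R E \<longleftrightarrow>
     (\<exists>q :: nat \<Rightarrow> nat \<Rightarrow> nat \<Rightarrow> complex.
        (\<forall>i\<le>diameter R. \<forall>j\<le>diameter R.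
           (\<lambda>x y. E i x y * E j x y) =
           (\<lambda>x y. (1 / of_nat (card (UNIV :: 'a set))) * (\<Sum>h\<le>diameter R. q h i j * E h x y))) \<and>
        (\<forall>h\<le>diameter R. \<forall>i\<le>diameter R. \<forall>j\<le>diameter R.
           (h > i + j \<or> i > h + j \<or> j > h + i) \<longrightarrow> q h i j = 0) \<and>
        (\<forall>h\<le>diameter R. \<forall>i\<le>diameter R. \<forall>j\<le>diameter R.
           (h = i + j \<or> i = h + j \<or> j = h + i) \<longrightarrow> q h i j \<noteq> 0))"

definition dual_width ::
  "('a::finite \<Rightarrow> 'a \<Rightarrow> bool) \<Rightarrow> (nat \<Rightarrow> 'a \<Rightarrow> 'a \<Rightarrow> complex) \<Rightarrow> ('a \<Rightarrow> complex) \<Rightarrow> nat" where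
  "dual_width R E v = Max {i. i \<le> diameter R \<and> mat_vec (E i) v \<noteq> (\<lambda>x. 0)}"

end

theory Submission
  imports Defs "HOL-Library.Function_Algebras"
begin

text \<open>
  Fix the base vertex \<open>x\<close> with dual idempotents \<open>E*\<^sub>i\<close>, and let \<open>Z\<close> be the sum of the spaces
  \<open>(E*\<^sub>0V + ... + E*\<^sub>iV) \<inter> (E\<^sub>0V + ... + E\<^sub>jV)\<close> over \<open>i + j = D - 1\<close>. A vector violating the claim
  lies in \<open>Z\<close>, so it suffices to show \<open>Z = 0\<close>. Subtracting the top eigenvalue shows that \<open>A\<close> raises
  \<open>i\<close> and lowers \<open>j\<close> by one, and \<open>A*\<close> does the opposite, so \<open>Z\<close> is invariant under \<open>A\<close> and \<open>A*\<close>,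
  hence under all \<open>A\<^sub>k\<close>, \<open>E\<^sub>j\<close>, \<open>A*\<^sub>k\<close>, \<open>E*\<^sub>i\<close>. If \<open>Z \<noteq> 0\<close>, let \<open>r\<close> and \<open>t\<close> be the least indices with
  \<open>E*\<^sub>rZ \<noteq> 0\<close> and \<open>E\<^sub>tZ \<noteq> 0\<close>. Then only \<open>i \<le> D - 1 - t\<close> contributes to \<open>Z\<close>, whereas \<open>A\<^sub>D\<close>, which
  is invertible, maps \<open>E*\<^sub>rZ\<close> into the part of \<open>Z\<close> at distance at least \<open>D - r\<close>; so \<open>t < r\<close>. The
  dual argument with \<open>A*\<^sub>D\<close> gives \<open>r < t\<close>, a contradiction.
\<close>

section \<open>Operators satisfying a three-term recurrence\<close>

text \<open>
  In the application, \<open>e j\<close>, \<open>f i\<close>, \<open>P k\<close> are \<open>E\<^sub>j\<close>, \<open>E*\<^sub>i\<close>, \<open>A\<^sub>k\<close> or, dually,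
  \<open>E*\<^sub>j\<close>, \<open>E\<^sub>i\<close>, \<open>|X|\<^sup>-\<^sup>1 A*\<^sub>k\<close>.
\<close>
locale three_term_system = vector_space scale
  for scale :: "'k::field \<Rightarrow> 'v::ab_group_add \<Rightarrow> 'v" (infixr "*s" 75) +
  fixes D :: nat and e f P :: "nat \<Rightarrow> 'v \<Rightarrow> 'v"
  assumes D_pos: "1 \<le> D"
    and hom_e: "j \<le> D \<Longrightarrow> module_hom scale scale (e j)"
    and hom_f: "j \<le> D \<Longrightarrow> module_hom scale scale (f j)"
    and hom_P: "j \<le> D \<Longrightarrow> module_hom scale scale (P j)"
    and e_orth: "i \<le> D \<Longrightarrow> j \<le> D \<Longrightarrow> e i (e j z) = (if i = j then e j z else 0)"
    and f_orth: "i \<le> D \<Longrightarrow> j \<le> D \<Longrightarrow> f i (f j z) = (if i = j then f j z else 0)"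
    and e_sum: "(\<Sum>j\<le>D. e j z) = z"
    and f_sum: "(\<Sum>j\<le>D. f j z) = z"
    and P_expand: "\<exists>a. \<forall>k\<le>D. \<forall>z. P k z = (\<Sum>j\<le>D. a k j *s e j z)"
    and e_expand: "\<exists>a. \<forall>j\<le>D. \<forall>z. e j z = (\<Sum>k\<le>D. a j k *s P k z)"
    and P_0: "\<exists>r. r \<noteq> 0 \<and> (\<forall>z. P 0 z = r *s z)"
    and three_term: "\<exists>p. (\<forall>k\<le>D. \<forall>z. P 1 (P k z) = (\<Sum>h\<le>D. p h k *s P h z)) \<and>
      (\<forall>h\<le>D. \<forall>k\<le>D. h > k + 1 \<or> k > h + 1 \<longrightarrow> p h k = 0) \<and>
      (\<forall>h\<le>D. \<forall>k\<le>D. h = k + 1 \<or> k = h + 1 \<longrightarrow> p h k \<noteq> 0)"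
    and triangle: "h \<le> D \<Longrightarrow> i \<le> D \<Longrightarrow> k \<le> D \<Longrightarrow> h > i + k \<or> k > h + i \<Longrightarrow>
      f h (P k (f i z)) = 0"
begin

text \<open>Strict cut-off: the components of \<open>z \<in> lower g i\<close> have index \<open>< i\<close>, so \<open>lower g 0\<close> is trivial.\<close>
definition lower :: "(nat \<Rightarrow> 'v \<Rightarrow> 'v) \<Rightarrow> nat \<Rightarrow> 'v set" where
  "lower g i = {z. \<forall>h\<le>D. i \<le> h \<longrightarrow> g h z = 0}"

text \<open>This is \<open>Z\<close>. With strict cut-offs the condition
  \<open>i + j = D - 1\<close> on top indices becomes a sum of \<open>D + 1\<close>; the end cases
  \<open>i = 0\<close> and \<open>i = D + 1\<close> contribute only \<open>0\<close>.\<close>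

definition split_span :: "'v set" where
  "split_span = span (\<Union>i\<le>D + 1. lower f i \<inter> lower e (D + 1 - i))"

lemma subspace_split_span: "subspace split_span"
  by (simp add: split_span_def)

lemma hom_simps:
  assumes "module_hom scale scale g"
  shows "g 0 = 0" "g (x + y) = g x + g y" "g (x - y) = g x - g y" "g (c *s x) = c *s g x"
    "g (sum F A) = (\<Sum>a\<in>A. g (F a))"
  using module_hom.zero[OF assms] module_hom.add[OF assms] module_hom.diff[OF assms]
    module_hom.scale[OF assms] module_hom.sum[OF assms] by auto

lemma subspace_lower:
  assumes "\<And>j. j \<le> D \<Longrightarrow> module_hom scale scale (g j)"
  shows "subspace (lower g i)"
  unfolding subspace_def lower_def using assms by (auto simp: hom_simps)

lemma split_spanI:
  assumes "i + j = D + 1" "z \<in> lower f i" "z \<in> lower e j"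
  shows "z \<in> split_span"
  unfolding split_span_def
proof (rule span_base)
  have "j = D + 1 - i" "i \<le> D + 1" using assms(1) by auto
  then show "z \<in> (\<Union>i\<le>D + 1. lower f i \<inter> lower e (D + 1 - i))"
    using assms by auto
qed

lemma split_span_subset:
  assumes "subspace S"
    and "\<And>i j z. i + j = D + 1 \<Longrightarrow> z \<in> lower f i \<Longrightarrow> z \<in> lower e j \<Longrightarrow> z \<in> S"
  shows "split_span \<subseteq> S"
  unfolding split_span_def
proof (rule span_minimal[OF _ assms(1)], clarsimp)
  fix i z assume "i \<le> Suc D" "z \<in> lower f i" "z \<in> lower e (Suc D - i)"
  then show "z \<in> S" using assms(2)[of i "Suc D - i" z] by simp
qed

section \<open>Invariance of \<open>split_span\<close> under the operators\<close>

lemma lower_0_e: "z \<in> lower e 0 \<Longrightarrow> z = 0"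
  using e_sum[of z] by (simp add: lower_def)

text \<open>By \<open>triangle\<close> with \<open>k = 1\<close>, a component of index
  \<open>l\<close> only reaches indices up to \<open>l + 1\<close>.\<close>

lemma P_1_shifts_f:
  assumes z: "z \<in> lower f i"
  shows "P 1 z \<in> lower f (i + 1)"
proof -
  have "f h (P 1 z) = 0" if h: "h \<le> D" "i + 1 \<le> h" for h
  proof -
    have "f h (P 1 z) = f h (P 1 (\<Sum>l\<le>D. f l z))" by (simp add: f_sum)
    also have "\<dots> = (\<Sum>l\<le>D. f h (P 1 (f l z)))"
      using h D_pos by (simp add: hom_simps[OF hom_P] hom_simps[OF hom_f])
    also have "\<dots> = 0"
    proof (rule sum.neutral, rule ballI)
      fix l assume l: "l \<in> {..D}"
      show "f h (P 1 (f l z)) = 0"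
      proof (cases "i \<le> l")
        case True
        then have "f l z = 0" using z l by (simp add: lower_def)
        then show ?thesis using h D_pos l by (simp add: hom_simps[OF hom_P] hom_simps[OF hom_f])
      next
        case False
        then show ?thesis using triangle[of h l 1 z] h l D_pos by auto
      qed
    qed
    finally show ?thesis .
  qed
  then show ?thesis by (simp add: lower_def)
qed

text \<open>On generators: subtracting the eigenvalue of \<open>P 1\<close> on the top
  \<open>e\<close>-component removes that component, while the \<open>f\<close> cut-off rises by
  one, so \<open>(i, j)\<close> becomes \<open>(i + 1, j - 1)\<close>.\<close>

lemma P_1_split_span:
  assumes "z \<in> split_span"
  shows "P 1 z \<in> split_span"
proof -
  obtain a where a: "\<And>k z. k \<le> D \<Longrightarrow> P k z = (\<Sum>j\<le>D. a k j *s e j z)"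
    using P_expand by blast
  have eP: "e h (P 1 z) = a 1 h *s e h z" if "h \<le> D" for h z
  proof -
    have "e h (P 1 z) = (\<Sum>j\<le>D. a 1 j *s e h (e j z))"
      using that D_pos by (simp add: a hom_simps[OF hom_e])
    also have "\<dots> = (\<Sum>j\<le>D. if j = h then a 1 h *s e h z else 0)"
      using that by (intro sum.cong) (auto simp: e_orth)
    also have "\<dots> = a 1 h *s e h z" using that by simp
    finally show ?thesis .
  qed
  have "split_span \<subseteq> {z. P 1 z \<in> split_span}"
  proof (rule split_span_subset)
    show "subspace {z. P 1 z \<in> split_span}"
      using subspace_split_span D_pos unfolding subspace_def
      by (auto simp: hom_simps[OF hom_P])
  next
    fix i j z assume ij: "i + j = D + 1" and z: "z \<in> lower f i" "z \<in> lower e j"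
    have zZ: "z \<in> split_span" using split_spanI[OF ij z] .
    show "z \<in> {z. P 1 z \<in> split_span}"
    proof (cases j)
      case 0
      then have "z = 0" using z lower_0_e by simp
      then show ?thesis using subspace_0[OF subspace_split_span] D_pos
        by (simp add: hom_simps[OF hom_P])
    next
      case (Suc j')
      show ?thesis
      proof (cases "j' \<le> D")
        case True
        \<comment> \<open>By strictness, \<open>j' = j - 1\<close> is the largest
          \<open>e\<close>-index that \<open>z\<close> can have, and \<open>a 1 j'\<close> is the
          eigenvalue there.\<close>
        define y where "y = P 1 z - a 1 j' *s z"
        have f_i: "z \<in> lower f (i + 1)" using z(1) by (auto simp: lower_def)
        have "y \<in> lower f (i + 1)" unfolding y_def
          by (intro subspace_diff[OF subspace_lower] subspace_scale[OF subspace_lower]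
              P_1_shifts_f z hom_f f_i)
        moreover have "y \<in> lower e j'"
        proof -
          have "e h y = 0" if h: "h \<le> D" "j' \<le> h" for h
          proof (cases "h = j'")
            case True
            then show ?thesis using h unfolding y_def
              by (simp only: hom_simps[OF hom_e] eP) simp
          next
            case False
            then have "e h z = 0" using z(2) h Suc by (simp add: lower_def)
            then show ?thesis using h unfolding y_def
              by (simp only: hom_simps[OF hom_e] eP) simp
          qed
          then show ?thesis by (simp add: lower_def)
        qed
        ultimately have "y \<in> split_span" using split_spanI[of "i + 1" j' y] ij Suc by simp
        then have "y + a 1 j' *s z \<in> split_span"
          by (intro subspace_add[OF subspace_split_span] subspace_scale[OF subspace_split_span] zZ)
        then show ?thesis by (simp add: y_def)
      next
        case False
        then show ?thesis using ij Suc by simp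
      qed
    qed
  qed
  then show ?thesis using assms by auto
qed

text \<open>The coefficient of \<open>P (l + 1)\<close> in the recurrence for
  \<open>P 1 (P l z)\<close> is nonzero, so it can be solved for; inductively every
  \<open>P k\<close> is a polynomial in \<open>P 1\<close>.\<close>

lemma P_closed:
  assumes Z: "subspace Z" and P1: "\<And>z. z \<in> Z \<Longrightarrow> P 1 z \<in> Z"
    and z: "z \<in> Z"
  shows "k \<le> D \<Longrightarrow> P k z \<in> Z"
proof (induction k rule: less_induct)
  case (less k)
  obtain p where p_all: "(\<forall>k\<le>D. \<forall>z. P 1 (P k z) = (\<Sum>h\<le>D. p h k *s P h z)) \<and>
      (\<forall>h\<le>D. \<forall>k\<le>D. h > k + 1 \<or> k > h + 1 \<longrightarrow> p h k = 0) \<and>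
      (\<forall>h\<le>D. \<forall>k\<le>D. h = k + 1 \<or> k = h + 1 \<longrightarrow> p h k \<noteq> 0)"
    using three_term by (rule exE)
  note p = p_all[THEN conjunct1, rule_format]
    and p0 = p_all[THEN conjunct2, THEN conjunct1, rule_format]
    and p1 = p_all[THEN conjunct2, THEN conjunct2, rule_format]
  show ?case
  proof (cases k)
    case 0
    then show ?thesis using P_0 subspace_scale[OF Z z] by force
  next
    case (Suc l)
    have l: "l \<le> D" "k = l + 1" using Suc less.prems by auto
    have "P 1 (P l z) = (\<Sum>h\<in>{..D} - {k}. p h l *s P h z) + p k l *s P k z"
      using p[OF l(1)] less.prems by (simp add: sum.remove[of _ k] add.commute)
    then have "p k l *s P k z = P 1 (P l z) - (\<Sum>h\<in>{..D} - {k}. p h l *s P h z)"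
      by simp
    also have "\<dots> \<in> Z"
    proof (intro subspace_diff[OF Z] subspace_sum[OF Z] P1)
      show "P l z \<in> Z" using less.IH l by simp
      fix h assume h: "h \<in> {..D} - {k}"
      show "p h l *s P h z \<in> Z"
      proof (cases "h < k")
        case True
        then show ?thesis using less.IH h by (intro subspace_scale[OF Z]) auto
      next
        case False
        then have "p h l = 0" using p0[of h l] h l by auto
        then show ?thesis using subspace_0[OF Z] by simp
      qed
    qed
    finally have "inverse (p k l) *s (p k l *s P k z) \<in> Z" by (rule subspace_scale[OF Z])
    then show ?thesis using p1[of k l] l less.prems by simp
  qed
qed

text \<open>Each \<open>e j\<close> is a combination of the \<open>P k\<close>. Applied to the dual
  system, this gives closure under \<open>f\<close>.\<close>

lemma e_closed:
  assumes Z: "subspace Z" and P1: "\<And>z. z \<in> Z \<Longrightarrow> P 1 z \<in> Z"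
    and z: "z \<in> Z" and j: "j \<le> D"
  shows "e j z \<in> Z"
proof -
  obtain a where a: "\<And>j z. j \<le> D \<Longrightarrow> e j z = (\<Sum>k\<le>D. a j k *s P k z)"
    using e_expand by blast
  show ?thesis unfolding a[OF j]
    by (intro subspace_sum[OF Z] subspace_scale[OF Z] P_closed[OF Z P1 z]) auto
qed

text \<open>The three-term recurrence, run downwards, expresses every \<open>P k\<close> through \<open>P D\<close>.\<close>
lemma P_D_injective:
  assumes 0: "P D z = 0"
  shows "z = 0"
proof -
  obtain p where p_all: "(\<forall>k\<le>D. \<forall>z. P 1 (P k z) = (\<Sum>h\<le>D. p h k *s P h z)) \<and>
      (\<forall>h\<le>D. \<forall>k\<le>D. h > k + 1 \<or> k > h + 1 \<longrightarrow> p h k = 0) \<and>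
      (\<forall>h\<le>D. \<forall>k\<le>D. h = k + 1 \<or> k = h + 1 \<longrightarrow> p h k \<noteq> 0)"
    using three_term by (rule exE)
  note p = p_all[THEN conjunct1, rule_format]
    and p0 = p_all[THEN conjunct2, THEN conjunct1, rule_format]
    and p1 = p_all[THEN conjunct2, THEN conjunct2, rule_format]
  have "\<forall>k. D - m \<le> k \<and> k \<le> D \<longrightarrow> P k z = 0" for m
  proof (induction m)
    case 0
    then show ?case using assms by auto
  next
    case (Suc m)
    show ?case
    proof (cases "m < D")
      case False
      then show ?thesis using Suc by simp
    next
      case True
      define h where "h = D - Suc m"
      have h: "h + 1 = D - m" "h + 1 \<le> D" using True by (auto simp: h_def)
      \<comment> \<open>Only the term in \<open>P h z\<close> survives: smaller indices drop out by
        tridiagonality, larger ones by induction.\<close>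
      have "0 = P 1 (P (h + 1) z)"
        using Suc h D_pos by (simp add: hom_simps[OF hom_P])
      also have "\<dots> = p h (h + 1) *s P h z + (\<Sum>l\<in>{..D} - {h}. p l (h + 1) *s P l z)"
        using p[OF h(2)] h(2) by (simp add: sum.remove[of _ h])
      also have "(\<Sum>l\<in>{..D} - {h}. p l (h + 1) *s P l z) = 0"
      proof (rule sum.neutral, rule ballI)
        fix l assume l: "l \<in> {..D} - {h}"
        show "p l (h + 1) *s P l z = 0"
        proof (cases "l < h")
          case True
          then show ?thesis using p0[of l "h + 1"] l h by simp
        next
          case False
          then show ?thesis using Suc l h by simp
        qed
      qed
      finally have "P h z = 0" using p1[of h "h + 1"] h by simp
      then show ?thesis using Suc unfolding h_def
        by (metis Suc_diff_Suc True le_antisym not_less_eq_eq)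
    qed
  qed
  from this[of D] have "P 0 z = 0" by simp
  then show ?thesis using P_0 by auto
qed

text \<open>If \<open>r \<le> t\<close>, then \<open>P D\<close> pushes \<open>f r z0\<close> to
  indices at least \<open>D - r\<close>, beyond every \<open>f\<close>-index available in
  \<open>split_span\<close>. Closure under \<open>f\<close> is assumed because one system alone
  yields only closure under \<open>e\<close>.\<close>

lemma dual_endpoint_less_endpoint:
  assumes fZ: "\<And>z i. z \<in> split_span \<Longrightarrow> i \<le> D \<Longrightarrow> f i z \<in> split_span"
    and r: "r \<le> D" "z0 \<in> split_span" "f r z0 \<noteq> 0"
    and t: "t \<le> D" "\<And>h z. h < t \<Longrightarrow> z \<in> split_span \<Longrightarrow> e h z = 0"
  shows "t < r"
proof (rule ccontr)
  assume "\<not> t < r"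
  have sub: "split_span \<subseteq> lower f (D - t)"
  proof (rule split_span_subset)
    show "subspace (lower f (D - t))" by (rule subspace_lower[OF hom_f])
    fix i j z assume ij: "i + j = D + 1" and z: "z \<in> lower f i" "z \<in> lower e j"
    have zZ: "z \<in> split_span" using split_spanI[OF ij z] .
    show "z \<in> lower f (D - t)"
    \<comment> \<open>If \<open>j \<le> t\<close>, the \<open>e\<close>-components below
      \<open>t\<close> vanish by the assumption on \<open>t\<close>, the others by the cut-off
      \<open>j\<close>. Otherwise \<open>j \<ge> t + 1\<close> forces
      \<open>i \<le> D - t\<close>.\<close>
    proof (cases "j \<le> t")
      case True
      then have "z \<in> lower e 0" using z(2) t(2)[OF _ zZ]
        unfolding lower_def by (auto simp: not_less[symmetric])
      then have "z = 0" by (rule lower_0_e)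
      then show ?thesis using subspace_0[OF subspace_lower[OF hom_f]] by simp
    next
      case False
      then have "i \<le> D - t" using ij by auto
      then show ?thesis using z(1) by (auto simp: lower_def)
    qed
  qed
  define y where "y = P D (f r z0)"
  have "y \<in> split_span" unfolding y_def
    by (rule P_closed[OF subspace_split_span P_1_split_span]) (auto intro: fZ r)
  have "f h y = 0" if h: "h \<le> D" for h
  proof (cases "h < D - r")
    case True
    then show ?thesis using triangle[of h r D z0] h r unfolding y_def by auto
  next
    case False
    then have "D - t \<le> h" using \<open>\<not> t < r\<close> by auto
    then show ?thesis using sub \<open>y \<in> split_span\<close> h by (auto simp: lower_def)
  qed
  then have "y = 0" using f_sum[of y] by simp
  then show False using P_D_injective r(3) unfolding y_def by blast
qed

end

text \<open>The two systems exchange \<open>e\<close> and \<open>f\<close>: each supplies the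
  closure the other lacks, and their endpoint inequalities contradict each other.\<close>

lemma lower_inter_eq_0:
  assumes "three_term_system scale D e f P" "three_term_system scale D f e Q"
    and "i + j = D + 1" and z: "\<And>h. h \<le> D \<Longrightarrow> i \<le> h \<Longrightarrow> f h z = 0"
      "\<And>h. h \<le> D \<Longrightarrow> j \<le> h \<Longrightarrow> e h z = 0"
  shows "z = 0"
proof (rule ccontr)
  assume "z \<noteq> 0"
  interpret A: three_term_system scale D e f P by fact
  interpret B: three_term_system scale D f e Q by fact
  \<comment> \<open>The generators are symmetric under exchanging \<open>f, i\<close> with
    \<open>e, j\<close>, so both systems have the same space.\<close>
  have "A.split_span = B.split_span"
  proof
    show "A.split_span \<subseteq> B.split_span"
      by (rule A.split_span_subset[OF B.subspace_split_span])
        (metis B.split_spanI add.commute)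
    show "B.split_span \<subseteq> A.split_span"
      by (rule B.split_span_subset[OF A.subspace_split_span])
        (metis A.split_spanI add.commute)
  qed
  note eq = this
  have zZ: "z \<in> A.split_span"
    using assms by (intro A.split_spanI[of i j]) (auto simp: A.lower_def)
  have e_cl: "e i y \<in> A.split_span" if "y \<in> A.split_span" "i \<le> D" for i y
    using A.e_closed[OF A.subspace_split_span A.P_1_split_span that] .
  have f_cl: "f i y \<in> A.split_span" if "y \<in> A.split_span" "i \<le> D" for i y
    using B.e_closed[OF B.subspace_split_span B.P_1_split_span] that eq by simp
  let ?p = "\<lambda>g r. r \<le> D \<and> (\<exists>y\<in>A.split_span. g r y \<noteq> 0)"
  have ex: "\<exists>r. ?p e r" "\<exists>r. ?p f r"
    using A.e_sum[of z] A.f_sum[of z] \<open>z \<noteq> 0\<close> zZ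
    by (metis atMost_iff sum.neutral)+
  define r where "r = (LEAST r. ?p f r)"
  define t where "t = (LEAST r. ?p e r)"
  have r: "?p f r" unfolding r_def by (rule LeastI_ex[OF ex(2)])
  have t: "?p e t" unfolding t_def by (rule LeastI_ex[OF ex(1)])
  have r': "f h y = 0" if "h < r" "y \<in> A.split_span" for h y
    using not_less_Least[of h "?p f"] that r unfolding r_def[symmetric] by auto
  have t': "e h y = 0" if "h < t" "y \<in> A.split_span" for h y
    using not_less_Least[of h "?p e"] that t unfolding t_def[symmetric] by auto
  have "t < r" using r t t' f_cl A.dual_endpoint_less_endpoint by blast
  moreover have "r < t" using r t r' e_cl B.dual_endpoint_less_endpoint eq by metis
  ultimately show False by simp
qed

section \<open>Distance-regular graphs and the Bose--Mesner algebra\<close>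

text \<open>Dimension count: \<open>D + 1\<close> independent vectors inside the span of at most
  \<open>D + 1\<close> vectors already span it. This inverts the expansion of the idempotents in
  distance matrices.\<close>

lemma (in vector_space) independent_family_spans:
  fixes B E :: "nat \<Rightarrow> 'b"
  assumes E: "\<And>j. j \<le> D \<Longrightarrow> E j \<in> span (B ` {..D})"
    and indep: "\<And>c j. (\<Sum>j\<le>D. scale (c j) (E j)) = 0 \<Longrightarrow> j \<le> D \<Longrightarrow> c j = 0"
    and k: "k \<le> D"
  shows "\<exists>a. B k = (\<Sum>j\<le>D. scale (a j) (E j))"
proof -
  have inj: "inj_on E {..D}"
  proof (rule inj_onI, rule ccontr)
    fix i j assume ij: "i \<in> {..D}" "j \<in> {..D}" "E i = E j" "i \<noteq> j"
    let ?c = "\<lambda>l. (if l = i then 1 else 0) - (if l = j then 1 else 0)"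
    have "(\<Sum>l\<le>D. scale (?c l) (E l)) =
        (\<Sum>l\<le>D. if l = i then E i else 0) - (\<Sum>l\<le>D. if l = j then E j else 0)"
      unfolding sum_subtractf[symmetric] by (intro sum.cong) (auto simp: scale_left_diff_distrib)
    also have "\<dots> = 0" using ij by simp
    finally show False using indep[of ?c i] ij by auto
  qed
  have ind: "independent (E ` {..D})"
  proof (rule independent_if_scalars_zero)
    fix f x assume f: "(\<Sum>x\<in>E ` {..D}. scale (f x) x) = 0" and x: "x \<in> E ` {..D}"
    have "(\<Sum>j\<le>D. scale (f (E j)) (E j)) = 0" using f by (simp add: sum.reindex[OF inj])
    then show "f x = 0" using indep[of "\<lambda>j. f (E j)"] x by auto
  qed simp
  have "B k \<in> span (E ` {..D})"
  proof (rule ccontr)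
    assume n: "B k \<notin> span (E ` {..D})"
    then have "independent (insert (B k) (E ` {..D}))" using ind by (rule independent_insertI)
    moreover have "insert (B k) (E ` {..D}) \<subseteq> span (B ` {..D})"
      using E k by (auto intro: span_base)
    ultimately have "card (insert (B k) (E ` {..D})) \<le> card (B ` {..D})"
      using independent_span_bound by blast
    also have "\<dots> \<le> D + 1" using card_image_le[of "{..D}" B] by simp
    finally have "card (insert (B k) (E ` {..D})) \<le> D + 1" .
    moreover have "B k \<notin> E ` {..D}" using n span_base[of "B k" "E ` {..D}"] by auto
    ultimately show False by (simp add: card_image[OF inj])
  qed
  then obtain u where "B k = (\<Sum>v\<in>E ` {..D}. scale (u v) v)"
    by (auto simp: span_finite)
  then have "B k = (\<Sum>j\<le>D. scale (u (E j)) (E j))" by (simp add: sum.reindex[OF inj])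
  then show ?thesis by (intro exI[of _ "\<lambda>j. u (E j)"])
qed

lemma sum_fun_apply: "(\<Sum>a\<in>A. F a) x = (\<Sum>a\<in>A. F a x)"
  by (induction A rule: infinite_finite_induct) auto

locale distance_regular_graph =
  fixes R :: "'a::finite \<Rightarrow> 'a \<Rightarrow> bool"
  assumes distance_regular: "distance_regular R"
begin

abbreviation d :: "'a \<Rightarrow> 'a \<Rightarrow> nat" where "d \<equiv> gdist R"
abbreviation D :: nat where "D \<equiv> diameter R"

section \<open>Path-length distance and intersection numbers\<close>

lemma walk_gdist: "(x, y) \<in> adjrel R ^^ d x y"
  using distance_regular unfolding distance_regular_def connected_graph_def gdist_def
  by (metis (mono_tags, lifting) LeastI_ex)

lemma gdist_le_walk: "(x, y) \<in> adjrel R ^^ n \<Longrightarrow> d x y \<le> n"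
  unfolding gdist_def by (rule Least_le)

lemma gdist_triangle: "d x z \<le> d x y + d y z"
proof (rule gdist_le_walk)
  show "(x, z) \<in> adjrel R ^^ (d x y + d y z)"
    unfolding relpow_add using walk_gdist[of x y] walk_gdist[of y z] by blast
qed

lemma walk_reverse: "(x, y) \<in> adjrel R ^^ n \<Longrightarrow> (y, x) \<in> adjrel R ^^ n"
proof (induction n arbitrary: y)
  case (Suc n)
  then obtain u where "(x, u) \<in> adjrel R ^^ n" "(u, y) \<in> adjrel R" by auto
  moreover from this have "(y, u) \<in> adjrel R"
    using distance_regular by (auto simp: adjrel_def distance_regular_def)
  ultimately show ?case using Suc.IH relpow_Suc_I2 by metis
qed simp

lemma gdist_commute: "d x y = d y x"
  using gdist_le_walk walk_reverse walk_gdist by (metis le_antisym)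

lemma gdist_eq_0: "d x y = 0 \<longleftrightarrow> x = y"
proof
  show "d x y = 0 \<Longrightarrow> x = y" using walk_gdist[of x y] by simp
  show "x = y \<Longrightarrow> d x y = 0" using gdist_le_walk[of x y 0] by simp
qed

text \<open>Take the first vertex of a shortest walk; the triangle inequality turns both upper
  bounds into equalities.\<close>

lemma gdist_Suc_neighbour:
  assumes "d x y = Suc n"
  obtains u where "d x u = 1" "d u y = n"
proof -
  have "(x, y) \<in> adjrel R ^^ Suc n" using walk_gdist[of x y] assms by simp
  then obtain u where u: "(x, u) \<in> adjrel R" "(u, y) \<in> adjrel R ^^ n"
    by (metis relpow_Suc_D2)
  have "d x u \<le> 1" using gdist_le_walk[of x u 1] u by simp
  moreover have "d u y \<le> n" using gdist_le_walk u by simp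
  ultimately have "d x u = 1" "d u y = n" using gdist_triangle[of x y u] assms by auto
  then show thesis by (rule that)
qed

lemma gdist_le_D: "d x y \<le> D"
proof -
  have "{gdist R x y | x y. True} = (\<lambda>(x, y). gdist R x y) ` UNIV" by auto
  then have "finite {gdist R x y | x y. True}" by simp
  then show ?thesis unfolding diameter_def by (rule Max_ge) auto
qed

text \<open>Start from a pair at distance \<open>D\<close> and drop the first step of a shortest
  walk to lower the distance by one each time.\<close>

lemma gdist_attained: "h \<le> D \<Longrightarrow> \<exists>x y. d x y = h"
proof (induction "D - h" arbitrary: h)
  case 0
  have "{gdist R x y | x y. True} = (\<lambda>(x, y). gdist R x y) ` UNIV" by auto
  then have "Max {gdist R x y | x y. True} \<in> {gdist R x y | x y. True}"
    by (intro Max_in) auto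
  then have "D \<in> {gdist R x y | x y. True}" by (simp only: diameter_def)
  then show ?case using 0 by force
next
  case (Suc m)
  have "m = D - Suc h" "Suc h \<le> D" using Suc.hyps(2) by auto
  then obtain x y where "d x y = Suc h" using Suc.hyps(1) by blast
  then show ?case using gdist_Suc_neighbour by metis
qed

lemma intersection_numbers:
  "\<exists>p. \<forall>x y i j. card {z. d x z = i \<and> d y z = j} = p (d x y) i j"
proof -
  let ?g = "\<lambda>x y i j. card {z. d x z = i \<and> d y z = j}"
  define p where "p h = (let s = SOME s. d (fst s) (snd s) = h in ?g (fst s) (snd s))" for h
  have "?g x y i j = p (d x y) i j" for x y i j
  proof -
    define s where "s = (SOME s. d (fst s) (snd s) = d x y)"
    have "d (fst s) (snd s) = d x y" unfolding s_def by (rule someI[of _ "(x, y)"]) simp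
    then have "?g x y i j = ?g (fst s) (snd s) i j"
      using distance_regular[unfolded distance_regular_def, THEN conjunct2, THEN conjunct2,
          THEN conjunct2, rule_format, of x y "fst s" "snd s" i j] by simp
    then show ?thesis by (simp add: p_def s_def Let_def)
  qed
  then show ?thesis by blast
qed

lemma sum_distmat:
  "(\<Sum>i\<le>D. c i * distmat R i x y) = c (d x y)"
  using gdist_le_D[of x y] by (simp add: distmat_def if_distrib[of "(*) _"] cong: if_cong)

lemma bose_mesner_iff: "M \<in> bose_mesner R \<longleftrightarrow> (\<exists>c. \<forall>x y. M x y = c (d x y))"
  unfolding bose_mesner_def by (auto simp: sum_distmat fun_eq_iff)

end

section \<open>Matrices acting on vectors\<close>

lemma mat_vec_mat_vec: "mat_vec M (mat_vec N z) = mat_vec (mat_mult M N) z"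
proof
  fix x
  have "mat_vec M (mat_vec N z) x = (\<Sum>y\<in>UNIV. \<Sum>w\<in>UNIV. M x y * N y w * z w)"
    by (simp add: mat_vec_def sum_distrib_left mult.assoc)
  also have "\<dots> = (\<Sum>w\<in>UNIV. \<Sum>y\<in>UNIV. M x y * N y w * z w)" by (rule sum.swap)
  also have "\<dots> = mat_vec (mat_mult M N) z x"
    by (simp add: mat_vec_def mat_mult_def sum_distrib_right)
  finally show "mat_vec M (mat_vec N z) x = mat_vec (mat_mult M N) z x" .
qed

lemma mat_vec_sum:
  assumes "\<And>x y. M x y = (\<Sum>j\<in>A. c j * N j x y)"
  shows "mat_vec M z x = (\<Sum>j\<in>A. c j * mat_vec (N j) z x)"
proof -
  have "mat_vec M z x = (\<Sum>y\<in>UNIV. \<Sum>j\<in>A. c j * (N j x y * z y))"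
    by (simp add: mat_vec_def assms sum_distrib_right mult.assoc)
  also have "\<dots> = (\<Sum>j\<in>A. \<Sum>y\<in>UNIV. c j * (N j x y * z y))" by (rule sum.swap)
  finally show ?thesis by (simp add: mat_vec_def sum_distrib_left)
qed

definition vscale :: "complex \<Rightarrow> ('a \<Rightarrow> complex) \<Rightarrow> 'a \<Rightarrow> complex" where
  "vscale c z = (\<lambda>y. c * z y)"

lemma vector_space_vscale: "vector_space (vscale :: complex \<Rightarrow> ('a \<Rightarrow> complex) \<Rightarrow> _)"
  by unfold_locales (auto simp: vscale_def fun_eq_iff algebra_simps)

lemma module_hom_vscaleI:
  assumes "\<And>x y. g (x + y) = g x + g y" "\<And>c x. g (vscale c x) = vscale c (g x)"
  shows "module_hom vscale vscale g"
proof -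
  interpret V: vector_space "vscale :: complex \<Rightarrow> ('b \<Rightarrow> complex) \<Rightarrow> _"
    by (rule vector_space_vscale)
  interpret W: vector_space "vscale :: complex \<Rightarrow> ('a \<Rightarrow> complex) \<Rightarrow> _"
    by (rule vector_space_vscale)
  show ?thesis by unfold_locales (use assms in auto)
qed

lemma module_hom_mat_vec: "module_hom vscale vscale (mat_vec M)"
  by (rule module_hom_vscaleI)
    (auto simp: mat_vec_def vscale_def fun_eq_iff algebra_simps sum.distrib sum_distrib_left)

section \<open>The Q-polynomial structure\<close>

text \<open>Fixing \<open>q\<close>, which \<open>q_polynomial\<close> only asserts to exist, lets
  all later lemmas share one choice of Krein parameters.\<close>

locale q_polynomial_graph = distance_regular_graph +
  fixes E :: "nat \<Rightarrow> 'a \<Rightarrow> 'a \<Rightarrow> complex" and q :: "nat \<Rightarrow> nat \<Rightarrow> nat \<Rightarrow> complex"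
  assumes D_pos: "1 \<le> diameter R"
    and prim: "primitive_idempotents R E"
    and krein: "i \<le> diameter R \<Longrightarrow> j \<le> diameter R \<Longrightarrow> E i x y * E j x y =
      (1 / of_nat (card (UNIV :: 'a set))) * (\<Sum>h\<le>diameter R. q h i j * E h x y)"
    and krein_zero: "h \<le> diameter R \<Longrightarrow> i \<le> diameter R \<Longrightarrow> j \<le> diameter R \<Longrightarrow>
      h > i + j \<or> i > h + j \<or> j > h + i \<Longrightarrow> q h i j = 0"
    and krein_nonzero: "h \<le> diameter R \<Longrightarrow> i \<le> diameter R \<Longrightarrow> j \<le> diameter R \<Longrightarrow>
      h = i + j \<or> i = h + j \<or> j = h + i \<Longrightarrow> q h i j \<noteq> 0"
begin

section \<open>Expansions in the primitive idempotents\<close>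

lemma E_mult: "i \<le> D \<Longrightarrow> j \<le> D \<Longrightarrow>
    (\<Sum>y\<in>UNIV. E i x y * E j y z) = (if i = j then E i x z else 0)"
  using prim unfolding primitive_idempotents_def mat_mult_def by (auto simp: fun_eq_iff)

lemma E_sum: "(\<Sum>i\<le>D. E i x y) = (if x = y then 1 else 0)"
  using prim unfolding primitive_idempotents_def id_mat_def fun_eq_iff by blast

lemma E_class_function: "\<exists>c. \<forall>j\<le>D. \<forall>x y. E j x y = c j (d x y)"
proof -
  have "\<forall>j. \<exists>c. j \<le> D \<longrightarrow> (\<forall>x y. E j x y = c (d x y))"
    using prim unfolding primitive_idempotents_def bose_mesner_iff by blast
  then show ?thesis by metis
qed

lemma E_commute: "j \<le> D \<Longrightarrow> E j x y = E j y x"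
  using E_class_function gdist_commute by metis

text \<open>Orthogonality leaves a single term of the product; \<open>c i\<close> is the eigenvalue
  of \<open>M\<close> on the \<open>i\<close>-th eigenspace.\<close>

lemma E_times_expansion:
  assumes "\<And>x y. M x y = (\<Sum>j\<le>D. c j * E j x y)" "i \<le> D"
  shows "(\<Sum>y\<in>UNIV. E i x y * M y z) = c i * E i x z"
proof -
  have "(\<Sum>y\<in>UNIV. E i x y * M y z) = (\<Sum>y\<in>UNIV. \<Sum>j\<le>D. c j * (E i x y * E j y z))"
    by (simp add: assms(1) sum_distrib_left mult.left_commute)
  also have "\<dots> = (\<Sum>j\<le>D. \<Sum>y\<in>UNIV. c j * (E i x y * E j y z))" by (rule sum.swap)
  also have "\<dots> = (\<Sum>j\<le>D. if j = i then c i * E i x z else 0)"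
    using assms(2) by (intro sum.cong) (auto simp: sum_distrib_left[symmetric] E_mult)
  also have "\<dots> = c i * E i x z" using assms(2) by simp
  finally show ?thesis .
qed

lemma E_coeff_unique:
  assumes "\<And>x y. (\<Sum>j\<le>D. b j * E j x y) = (\<Sum>j\<le>D. c j * E j x y)" "i \<le> D"
  shows "b i = c i"
proof -
  have "E i \<noteq> (\<lambda>x y. 0)"
    using prim assms(2) unfolding primitive_idempotents_def by blast
  then obtain x z where "E i x z \<noteq> 0" by (auto simp: fun_eq_iff)
  moreover have "b i * E i x z = c i * E i x z"
    using E_times_expansion[of "\<lambda>x y. \<Sum>j\<le>D. b j * E j x y" b i x z]
      E_times_expansion[of "\<lambda>x y. \<Sum>j\<le>D. b j * E j x y" c i x z] assms by simp
  ultimately show ?thesis by simp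
qed

lemma distmat_in_span_E:
  assumes "k \<le> D"
  shows "\<exists>a. \<forall>x y. distmat R k x y = (\<Sum>j\<le>D. a j * E j x y)"
proof -
  define ms where "ms c M = (\<lambda>x y. c * M x y)" for c and M :: "'a \<Rightarrow> 'a \<Rightarrow> complex"
  interpret M: vector_space ms
    by unfold_locales (auto simp: ms_def fun_eq_iff algebra_simps)
  have "\<exists>a. distmat R k = (\<Sum>j\<le>D. ms (a j) (E j))"
  proof (rule M.independent_family_spans[OF _ _ assms])
    fix j assume "j \<le> D"
    then obtain c where c: "\<And>x y. E j x y = c (d x y)" using E_class_function by blast
    have "E j = (\<Sum>i\<le>D. ms (c i) (distmat R i))"
      by (simp add: fun_eq_iff sum_fun_apply ms_def c sum_distmat)
    also have "\<dots> \<in> M.span (distmat R ` {..D})"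
      by (intro M.span_sum M.span_scale M.span_base) auto
    finally show "E j \<in> M.span (distmat R ` {..D})" .
  next
    fix c j assume "(\<Sum>j\<le>D. ms (c j) (E j)) = 0" "j \<le> D"
    then show "c j = 0"
      using E_coeff_unique[of c "\<lambda>_. 0" j] by (simp add: fun_eq_iff sum_fun_apply ms_def)
  qed
  then show ?thesis by (auto simp: sum_fun_apply ms_def)
qed

lemma class_function_in_span_E: "\<exists>a. \<forall>x y. c (d x y) = (\<Sum>j\<le>D. a j * E j x y)"
proof -
  obtain a where a: "\<And>k x y. k \<le> D \<Longrightarrow> distmat R k x y = (\<Sum>j\<le>D. a k j * E j x y)"
    using distmat_in_span_E by metis
  have "c (d x y) = (\<Sum>j\<le>D. (\<Sum>k\<le>D. c k * a k j) * E j x y)" for x y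
  proof -
    have "c (d x y) = (\<Sum>k\<le>D. \<Sum>j\<le>D. c k * a k j * E j x y)"
      by (simp add: sum_distmat[symmetric] a sum_distrib_left mult.assoc)
    also have "\<dots> = (\<Sum>j\<le>D. \<Sum>k\<le>D. c k * a k j * E j x y)" by (rule sum.swap)
    finally show ?thesis by (simp add: sum_distrib_right)
  qed
  then show ?thesis by (intro exI[of _ "\<lambda>j. \<Sum>k\<le>D. c k * a k j"]) simp
qed

text \<open>Among the \<open>q h 0 j\<close> only \<open>q j 0 j\<close> survives, so entrywise
  multiplication by \<open>E 0\<close> scales each \<open>E j\<close> by a nonzero
  \<open>c j\<close>. Comparing two expansions of \<open>E 0\<close> then shows that the all-ones
  matrix is a multiple of \<open>E 0\<close>. This yields \<open>P_0\<close> in the dual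
  system.\<close>

lemma E_0_constant: "\<exists>r. r \<noteq> 0 \<and> (\<forall>x y. E 0 x y = r)"
proof -
  obtain s where s: "\<And>x y. 1 = (\<Sum>j\<le>D. s j * E j x y)"
    using class_function_in_span_E[of "\<lambda>_. 1"] by auto
  define c where "c j = q j 0 j / of_nat (card (UNIV :: 'a set))" for j
  have c: "c j \<noteq> 0" if "j \<le> D" for j
    using krein_nonzero[of j 0 j] that by (simp add: c_def)
  have E0E: "E 0 x y * E j x y = c j * E j x y" if j: "j \<le> D" for j x y
  proof -
    have "(\<Sum>h\<le>D. q h 0 j * E h x y) = (\<Sum>h\<le>D. if h = j then q j 0 j * E j x y else 0)"
    proof (intro sum.cong refl)
      fix h assume "h \<in> {..D}"
      then show "q h 0 j * E h x y = (if h = j then q j 0 j * E j x y else 0)"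
        using krein_zero[of h 0 j] j by (cases h j rule: linorder_cases) auto
    qed
    then show ?thesis using krein[of 0 j x y] j by (simp add: c_def)
  qed
  have "(\<Sum>j\<le>D. (if j = 0 then 1 else 0) * E j x y) = (\<Sum>j\<le>D. (s j * c j) * E j x y)" for x y
  proof -
    have "(\<Sum>j\<le>D. (if j = 0 then 1 else 0) * E j x y) = E 0 x y * (\<Sum>j\<le>D. s j * E j x y)"
      by (simp add: s[symmetric] if_distrib[of "\<lambda>a. a * _"] cong: if_cong)
    also have "\<dots> = (\<Sum>j\<le>D. (s j * c j) * E j x y)"
      unfolding sum_distrib_left by (intro sum.cong) (auto simp: E0E mult.left_commute)
    finally show ?thesis .
  qed
  then have sc: "(if j = 0 then 1 else 0) = s j * c j" if "j \<le> D" for j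
    using E_coeff_unique[of "\<lambda>j. if j = 0 then 1 else 0" "\<lambda>j. s j * c j" j] that by blast
  have s0: "s j = 0" if "j \<le> D" "j \<noteq> 0" for j
    using sc[of j] c[of j] that by simp
  have E0: "1 = s 0 * E 0 x y" for x y
  proof -
    have "1 = (\<Sum>j\<le>D. s j * E j x y)" by (rule s)
    also have "\<dots> = (\<Sum>j\<le>D. if j = 0 then s 0 * E 0 x y else 0)"
      by (intro sum.cong) (auto simp: s0)
    finally show ?thesis by simp
  qed
  then have "s 0 \<noteq> 0" using E0[of undefined undefined] by auto
  then have "E 0 x y = 1 / s 0" for x y using E0[of x y] by (simp add: field_simps)
  then show ?thesis using \<open>s 0 \<noteq> 0\<close> by (intro exI[of _ "1 / s 0"]) auto
qed

text \<open>The entrywise conjugate of \<open>E h\<close> again depends only on the distance, so it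
  expands in the idempotents, and multiplying by \<open>E h\<close> leaves a multiple of
  \<open>E h\<close>.\<close>

lemma E_gram:
  assumes "h \<le> D"
  shows "\<exists>r. \<forall>u w. (\<Sum>a\<in>UNIV. E h a u * cnj (E h a w)) = r * E h u w"
proof -
  obtain c where c: "\<And>x y. E h x y = c (d x y)" using E_class_function assms by blast
  obtain s where s: "\<And>x y. cnj (c (d x y)) = (\<Sum>j\<le>D. s j * E j x y)"
    using class_function_in_span_E[of "\<lambda>k. cnj (c k)"] by auto
  have "(\<Sum>a\<in>UNIV. E h a u * cnj (E h a w)) = s h * E h u w" for u w
    using E_times_expansion[of "\<lambda>x y. cnj (E h x y)" s h u w] s assms c
      E_commute[of h u] by simp
  then show ?thesis by blast
qed

text \<open>The sum of the squared moduli of these triple sums is a multiple of \<open>q h k i\<close>.\<close>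
lemma triple_sum_zero:
  assumes hki: "h \<le> D" "k \<le> D" "i \<le> D" and q: "q h k i = 0"
  shows "(\<Sum>u\<in>UNIV. E h a u * E k b u * E i c u) = 0"
proof -
  let ?F = "\<lambda>(a, b, c). \<Sum>u\<in>UNIV. E h a u * E k b u * E i c u"
  obtain r where r: "\<And>j u w. j \<le> D \<Longrightarrow> (\<Sum>a\<in>UNIV. E j a u * cnj (E j a w)) = r j * E j u w"
    using E_gram by metis
  define m where "m = (1 / of_nat (card (UNIV :: 'a set)) :: complex)"
  have "(\<Sum>t\<in>UNIV. ?F t * cnj (?F t)) = (\<Sum>t\<in>UNIV. \<Sum>u\<in>UNIV. \<Sum>w\<in>UNIV.
      case t of (a, b, c) \<Rightarrow> (E h a u * cnj (E h a w)) * (E k b u * cnj (E k b w)) *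
        (E i c u * cnj (E i c w)))"
    by (intro sum.cong) (auto simp: sum_product intro!: sum.cong)
  \<comment> \<open>With \<open>u\<close> and \<open>w\<close> outermost, the sum over triples
    factors into three Gram sums, each given by \<open>E_gram\<close>.\<close>
  also have "\<dots> = (\<Sum>u\<in>UNIV. \<Sum>w\<in>UNIV. \<Sum>t\<in>UNIV.
      case t of (a, b, c) \<Rightarrow> (E h a u * cnj (E h a w)) * (E k b u * cnj (E k b w)) *
        (E i c u * cnj (E i c w)))"
    by (subst sum.swap, intro sum.cong refl, rule sum.swap)
  also have "\<dots> = (\<Sum>u\<in>UNIV. \<Sum>w\<in>UNIV. (r h * E h u w) * (r k * E k u w) * (r i * E i u w))"
  proof (intro sum.cong refl)
    fix u w
    have "(\<Sum>t\<in>UNIV. case t of (a, b, c) \<Rightarrow> (E h a u * cnj (E h a w)) * (E k b u * cnj (E k b w)) *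
        (E i c u * cnj (E i c w))) =
      (\<Sum>a\<in>UNIV. \<Sum>b\<in>UNIV. \<Sum>c\<in>UNIV. (E h a u * cnj (E h a w)) * (E k b u * cnj (E k b w)) *
        (E i c u * cnj (E i c w)))"
      by (simp add: sum.cartesian_product)
    also have "\<dots> = (\<Sum>a\<in>UNIV. E h a u * cnj (E h a w)) * (\<Sum>b\<in>UNIV. E k b u * cnj (E k b w)) *
        (\<Sum>c\<in>UNIV. E i c u * cnj (E i c w))"
      by (simp only: sum_distrib_left[symmetric] sum_distrib_right[symmetric])
    finally show "(\<Sum>t\<in>UNIV. case t of (a, b, c) \<Rightarrow> (E h a u * cnj (E h a w)) *
        (E k b u * cnj (E k b w)) * (E i c u * cnj (E i c w))) =
        (r h * E h u w) * (r k * E k u w) * (r i * E i u w)"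
      by (simp add: r hki)
  qed
  \<comment> \<open>The Krein expansion replaces \<open>E k u w * E i u w\<close>; the sum over
    \<open>w\<close> is then a matrix product with \<open>E h\<close>, which keeps only the
    coefficient \<open>q h k i\<close>.\<close>
  also have "\<dots> = (\<Sum>u\<in>UNIV. r h * r k * r i * m * (\<Sum>w\<in>UNIV. E h u w * (\<Sum>l\<le>D. q l k i * E l w u)))"
  proof (intro sum.cong refl)
    fix u
    have "(r h * E h u w) * (r k * E k u w) * (r i * E i u w) =
        r h * r k * r i * m * (E h u w * (\<Sum>l\<le>D. q l k i * E l w u))" for w
      using krein[of k i w u] hki E_commute[of k w u] E_commute[of i w u]
      by (simp add: m_def mult.assoc mult.left_commute)
    then show "(\<Sum>w\<in>UNIV. (r h * E h u w) * (r k * E k u w) * (r i * E i u w)) =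
        r h * r k * r i * m * (\<Sum>w\<in>UNIV. E h u w * (\<Sum>l\<le>D. q l k i * E l w u))"
      by (simp add: sum_distrib_left)
  qed
  also have "\<dots> = 0"
    using E_times_expansion[of "\<lambda>x y. \<Sum>l\<le>D. q l k i * E l x y" "\<lambda>l. q l k i" h] hki q by simp
  finally have "(\<Sum>t\<in>UNIV. complex_of_real ((cmod (?F t))\<^sup>2)) = 0"
    by (simp only: complex_norm_square)
  then have "(\<Sum>t\<in>UNIV. (cmod (?F t))\<^sup>2) = 0"
    by (simp only: of_real_sum[symmetric] of_real_eq_0_iff)
  then have "\<forall>t\<in>UNIV. (cmod (?F t))\<^sup>2 = 0"
    by (subst (asm) sum_nonneg_eq_0_iff) auto
  from bspec[OF this, of "(a, b, c)"] show ?thesis by simp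
qed

section \<open>The two systems based at a vertex\<close>

lemma sum_E_mat_vec: "(\<Sum>j\<le>D. mat_vec (E j) z) = z"
proof
  fix y
  have "z y = mat_vec (\<lambda>x y. \<Sum>j\<le>D. 1 * E j x y) z y"
    by (simp add: E_sum mat_vec_def if_distrib[of "\<lambda>a. a * _"] cong: if_cong)
  also have "\<dots> = (\<Sum>j\<le>D. mat_vec (E j) z y)"
    by (subst mat_vec_sum[of _ "\<lambda>_. 1" E "{..D}"]) auto
  finally show "(\<Sum>j\<le>D. mat_vec (E j) z) y = z y" by (simp add: sum_fun_apply)
qed

lemma E_mat_vec_orth: "i \<le> D \<Longrightarrow> j \<le> D \<Longrightarrow>
    mat_vec (E i) (mat_vec (E j) z) = (if i = j then mat_vec (E j) z else 0)"
  using prim unfolding mat_vec_mat_vec primitive_idempotents_def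
  by (auto simp: mat_vec_def fun_eq_iff)

text \<open>\<open>dual_proj x i\<close> is the dual idempotent \<open>E*\<^sub>i\<close> with respect to the base vertex \<open>x\<close>.\<close>
definition dual_proj :: "'a \<Rightarrow> nat \<Rightarrow> ('a \<Rightarrow> complex) \<Rightarrow> 'a \<Rightarrow> complex" where
  "dual_proj x i z = (\<lambda>y. if d x y = i then z y else 0)"

lemma module_hom_dual_proj: "module_hom vscale vscale (dual_proj x i)"
  by (rule module_hom_vscaleI) (auto simp: dual_proj_def vscale_def fun_eq_iff)

lemma sum_dual_proj: "(\<Sum>i\<le>D. dual_proj x i z) = z"
  using gdist_le_D by (simp add: fun_eq_iff sum_fun_apply dual_proj_def)

lemma dual_proj_orth: "dual_proj x i (dual_proj x j z) = (if i = j then dual_proj x j z else 0)"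
  by (auto simp: dual_proj_def fun_eq_iff)

text \<open>The coefficients are the intersection numbers \<open>p h 1 k\<close>: zero when the
  triangle inequality forbids distances \<open>h\<close>, \<open>1\<close>, \<open>k\<close>, and
  positive when the first step of a shortest walk realises them.\<close>

lemma adjacency_recurrence:
  "\<exists>p. (\<forall>k\<le>D. \<forall>z. mat_vec (distmat R 1) (mat_vec (distmat R k) z) =
        (\<Sum>h\<le>D. vscale (p h k) (mat_vec (distmat R h) z))) \<and>
      (\<forall>h\<le>D. \<forall>k\<le>D. h > k + 1 \<or> k > h + 1 \<longrightarrow> p h k = 0) \<and>
      (\<forall>h\<le>D. \<forall>k\<le>D. h = k + 1 \<or> k = h + 1 \<longrightarrow> p h k \<noteq> 0)"
proof -
  obtain p where p: "\<And>x y i j. card {z. d x z = i \<and> d y z = j} = p (d x y) i j"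
    using intersection_numbers by blast
  define p' where "p' h k = (of_nat (p h 1 k) :: complex)" for h k
  have mult: "mat_mult (distmat R 1) (distmat R k) x y = (\<Sum>h\<le>D. p' h k * distmat R h x y)" for k x y
  proof -
    have "mat_mult (distmat R 1) (distmat R k) x y = (\<Sum>u\<in>UNIV. of_bool (d x u = 1 \<and> d y u = k))"
      unfolding mat_mult_def distmat_def
      by (intro sum.cong) (auto simp: gdist_commute[of _ y])
    also have "\<dots> = p' (d x y) k" by (simp add: sum_of_bool_eq p p'_def)
    finally show ?thesis by (simp add: sum_distmat)
  qed
  have 1: "mat_vec (distmat R 1) (mat_vec (distmat R k) z) =
        (\<Sum>h\<le>D. vscale (p' h k) (mat_vec (distmat R h) z))" for k z
    unfolding mat_vec_mat_vec
    by (simp add: fun_eq_iff sum_fun_apply vscale_def mat_vec_sum[OF mult] del: One_nat_def)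
  have 2: "p' h k = 0" if h: "h \<le> D" and hk: "h > k + 1 \<or> k > h + 1" for h k
  proof -
    obtain x y where xy: "d x y = h" using gdist_attained[OF h] by blast
    have "\<not> (d x z = 1 \<and> d y z = k)" for z
      using gdist_triangle[of x y z] gdist_triangle[of y z x] xy hk
        gdist_commute[of z y] gdist_commute[of y x] by auto
    then have "{z. d x z = 1 \<and> d y z = k} = {}" by blast
    then have "p h 1 k = 0" using p[of x 1 y k] xy by (metis card.empty)
    then show ?thesis by (simp add: p'_def)
  qed
  have 3: "p' h k \<noteq> 0" if h: "h \<le> D" "k \<le> D" and hk: "h = k + 1 \<or> k = h + 1" for h k
  proof -
    have "\<exists>x y u. d x y = h \<and> d x u = 1 \<and> d y u = k"
      using hk
    proof
      assume "h = k + 1"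
      moreover obtain x y where "d x y = h" using gdist_attained[OF h(1)] by blast
      ultimately show ?thesis using gdist_Suc_neighbour[of x y k] gdist_commute
        by (metis Suc_eq_plus1)
    next
      assume "k = h + 1"
      moreover obtain u y where "d u y = k" using gdist_attained[OF h(2)] by blast
      ultimately show ?thesis using gdist_Suc_neighbour[of u y h] gdist_commute
        by (metis Suc_eq_plus1)
    qed
    then obtain x y u where u: "d x y = h" "d x u = 1" "d y u = k" by blast
    then have "card {z. d x z = 1 \<and> d y z = k} \<noteq> 0" by (auto simp: card_eq_0_iff)
    then have "p h 1 k \<noteq> 0" unfolding p u(1) .
    then show ?thesis by (simp add: p'_def)
  qed
  show ?thesis by (intro exI[of _ p'] conjI allI impI 1 2 3)
qed

lemma adjacency_system:
  "three_term_system vscale D (\<lambda>j. mat_vec (E j)) (dual_proj x) (\<lambda>k. mat_vec (distmat R k))"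
proof (rule three_term_system.intro, rule vector_space_vscale, rule three_term_system_axioms.intro)
  show "\<exists>a. \<forall>k\<le>D. \<forall>z. mat_vec (distmat R k) z = (\<Sum>j\<le>D. vscale (a k j) (mat_vec (E j) z))"
  proof -
    obtain a where a: "\<And>k x y. k \<le> D \<Longrightarrow> distmat R k x y = (\<Sum>j\<le>D. a k j * E j x y)"
      using distmat_in_span_E by metis
    show ?thesis
      by (intro exI[of _ a]) (simp add: fun_eq_iff sum_fun_apply vscale_def mat_vec_sum[OF a])
  qed
  show "\<exists>a. \<forall>j\<le>D. \<forall>z. mat_vec (E j) z = (\<Sum>k\<le>D. vscale (a j k) (mat_vec (distmat R k) z))"
  proof -
    obtain c where c: "\<And>j x y. j \<le> D \<Longrightarrow> E j x y = c j (d x y)" using E_class_function by blast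
    have "E j x y = (\<Sum>k\<le>D. c j k * distmat R k x y)" if "j \<le> D" for j x y
      using that by (simp add: c sum_distmat)
    note a = this
    show ?thesis
      by (intro exI[of _ c]) (simp add: fun_eq_iff sum_fun_apply vscale_def mat_vec_sum[OF a])
  qed
  have "mat_vec (distmat R 0) z = vscale 1 z" for z
    by (simp add: fun_eq_iff mat_vec_def distmat_def vscale_def gdist_eq_0
        if_distrib[of "\<lambda>a. a * _"] cong: if_cong)
  then show "\<exists>r. r \<noteq> 0 \<and> (\<forall>z. mat_vec (distmat R 0) z = vscale r z)"
    by (intro exI[of _ 1]) auto
  show "dual_proj x h (mat_vec (distmat R k) (dual_proj x i z)) = 0"
    if "h > i + k \<or> k > h + i" for h i k z
  proof -
    have "d x y = h \<Longrightarrow> d y u = k \<Longrightarrow> d x u \<noteq> i" for y u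
      using that gdist_triangle[of x y u] gdist_triangle[of y u x]
        gdist_commute[of u y] gdist_commute[of x y] by auto
    then show ?thesis
      by (auto simp: dual_proj_def mat_vec_def distmat_def fun_eq_iff intro!: sum.neutral)
  qed
qed (rule D_pos E_mat_vec_orth sum_E_mat_vec sum_dual_proj dual_proj_orth adjacency_recurrence
    module_hom_mat_vec module_hom_dual_proj; assumption)+

text \<open>\<open>P k\<close> is the diagonal operator given by row \<open>x\<close> of
  \<open>E k\<close>. Composing such operators multiplies idempotents entrywise, so the recurrence
  is the Krein expansion; \<open>triangle\<close> comes from \<open>triple_sum_zero\<close>.\<close>

lemma dual_adjacency_system:
  "three_term_system vscale D (dual_proj x) (\<lambda>j. mat_vec (E j)) (\<lambda>k z y. E k x y * z y)"
proof -
  have dp: "vscale (c d') (dual_proj x d' z) y = c d' * distmat R d' x y * z y" for c d' z y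
    by (simp add: vscale_def dual_proj_def distmat_def)
  show ?thesis
  proof (rule three_term_system.intro, rule vector_space_vscale, rule three_term_system_axioms.intro)
    show "\<exists>a. \<forall>k\<le>D. \<forall>z. (\<lambda>y. E k x y * z y) = (\<Sum>j\<le>D. vscale (a k j) (dual_proj x j z))"
    proof -
      obtain c where c: "\<And>j x y. j \<le> D \<Longrightarrow> E j x y = c j (d x y)" using E_class_function by blast
      show ?thesis
        by (intro exI[of _ c])
          (simp add: fun_eq_iff sum_fun_apply dp sum_distrib_right[symmetric] sum_distmat c)
    qed
    show "\<exists>a. \<forall>j\<le>D. \<forall>z. dual_proj x j z = (\<Sum>k\<le>D. vscale (a j k) (\<lambda>y. E k x y * z y))"
    proof -
      obtain a where a: "\<And>k x y. k \<le> D \<Longrightarrow> distmat R k x y = (\<Sum>j\<le>D. a k j * E j x y)"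
        using distmat_in_span_E by metis
      have "dual_proj x j z y = distmat R j x y * z y" for j z y
        by (simp add: dual_proj_def distmat_def)
      then show ?thesis
        by (intro exI[of _ a])
          (simp add: fun_eq_iff sum_fun_apply vscale_def a sum_distrib_right mult.assoc)
    qed
    show "\<exists>r. r \<noteq> 0 \<and> (\<forall>z. (\<lambda>y. E 0 x y * z y) = vscale r z)"
      using E_0_constant by (auto simp: vscale_def)
    show "\<exists>p. (\<forall>k\<le>D. \<forall>z. (\<lambda>y. E 1 x y * (E k x y * z y)) =
        (\<Sum>h\<le>D. vscale (p h k) (\<lambda>y. E h x y * z y))) \<and>
      (\<forall>h\<le>D. \<forall>k\<le>D. h > k + 1 \<or> k > h + 1 \<longrightarrow> p h k = 0) \<and>
      (\<forall>h\<le>D. \<forall>k\<le>D. h = k + 1 \<or> k = h + 1 \<longrightarrow> p h k \<noteq> 0)"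
    \<comment> \<open>The factor from the Krein expansion stays in the coefficients because the
      operators carry the scaling \<open>|X|\<^sup>-\<^sup>1\<close>.\<close>
    proof (intro exI[of _ "\<lambda>h k. 1 / of_nat (card (UNIV :: 'a set)) * q h 1 k"] conjI allI impI)
      fix k z assume "k \<le> D"
      then show "(\<lambda>y. E 1 x y * (E k x y * z y)) =
        (\<Sum>h\<le>D. vscale (1 / of_nat (card (UNIV :: 'a set)) * q h 1 k) (\<lambda>y. E h x y * z y))"
        using krein[of 1 k x] D_pos
        by (simp add: fun_eq_iff sum_fun_apply vscale_def mult.assoc[symmetric] sum_distrib_left
            sum_distrib_right)
    qed (use krein_zero krein_nonzero D_pos in auto)
    show "mat_vec (E h) (\<lambda>y. E k x y * mat_vec (E i) z y) = 0"
      if hik: "h \<le> D" "i \<le> D" "k \<le> D" and "h > i + k \<or> k > h + i" for h i k z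
    proof
      fix a
      have "q h k i = 0" using krein_zero[of h k i] that by auto
      then have F: "(\<Sum>u\<in>UNIV. E h a u * E k x u * E i c u) = 0" for c
        using triple_sum_zero hik by blast
      \<comment> \<open>Symmetry of \<open>E i\<close> puts the summed vertex \<open>u\<close>
        second, as in \<open>triple_sum_zero\<close>.\<close>
      have E_sym: "mat_vec (E i) z u = (\<Sum>c\<in>UNIV. E i c u * z c)" for u
        by (simp add: mat_vec_def E_commute[OF hik(2), of u])
      have "mat_vec (E h) (\<lambda>y. E k x y * mat_vec (E i) z y) a =
          (\<Sum>u\<in>UNIV. \<Sum>c\<in>UNIV. E h a u * E k x u * E i c u * z c)"
        by (simp add: E_sym mat_vec_def[of "E h"] sum_distrib_left mult.assoc)
      also have "\<dots> = (\<Sum>c\<in>UNIV. \<Sum>u\<in>UNIV. E h a u * E k x u * E i c u * z c)" by (rule sum.swap)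
      also have "\<dots> = 0" by (simp add: sum_distrib_right[symmetric] F)
      finally show "mat_vec (E h) (\<lambda>y. E k x y * mat_vec (E i) z y) a = 0 a" by simp
    qed
    show "module_hom vscale vscale (\<lambda>z y. E k x y * z y)" for k
      by (rule module_hom_vscaleI) (auto simp: vscale_def fun_eq_iff algebra_simps)
  qed (rule D_pos E_mat_vec_orth sum_E_mat_vec sum_dual_proj dual_proj_orth
      module_hom_mat_vec module_hom_dual_proj; assumption)+
qed

end

theorem mainTheorem11:
  fixes R :: "'a::finite \<Rightarrow> 'a \<Rightarrow> bool"
    and E :: "nat \<Rightarrow> 'a \<Rightarrow> 'a \<Rightarrow> complex"
    and v :: "'a \<Rightarrow> complex"
  assumes "distance_regular R"
    and "diameter R \<ge> 3"
    and "primitive_idempotents R E"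
    and "q_polynomial R E"
    and "v \<noteq> (\<lambda>x. 0)"
  shows "\<forall>x. \<exists>y. v y \<noteq> 0 \<and> gdist R x y \<ge> diameter R - dual_width R E v"
proof
  fix x
  from assms(4) obtain q where q: "(\<forall>i\<le>diameter R. \<forall>j\<le>diameter R.
           (\<lambda>x y. E i x y * E j x y) =
           (\<lambda>x y. (1 / of_nat (card (UNIV :: 'a set))) * (\<Sum>h\<le>diameter R. q h i j * E h x y))) \<and>
        (\<forall>h\<le>diameter R. \<forall>i\<le>diameter R. \<forall>j\<le>diameter R.
           (h > i + j \<or> i > h + j \<or> j > h + i) \<longrightarrow> q h i j = 0) \<and>
        (\<forall>h\<le>diameter R. \<forall>i\<le>diameter R. \<forall>j\<le>diameter R.
           (h = i + j \<or> i = h + j \<or> j = h + i) \<longrightarrow> q h i j \<noteq> 0)"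
    unfolding q_polynomial_def by (rule exE)
  interpret q_polynomial_graph R E q
  proof (unfold_locales)
    show "1 \<le> diameter R" using assms(2) by simp
    show "E i x y * E j x y =
        (1 / of_nat (card (UNIV :: 'a set))) * (\<Sum>h\<le>diameter R. q h i j * E h x y)"
      if "i \<le> diameter R" "j \<le> diameter R" for i j x y
      using q[THEN conjunct1, rule_format, OF that] by (rule fun_cong[THEN fun_cong])
  qed (use assms(1,3) q[THEN conjunct2] in blast)+
  define g where "g = dual_width R E v"
  let ?W = "{i. i \<le> D \<and> mat_vec (E i) v \<noteq> (\<lambda>x. 0)}"
  \<comment> \<open>This makes the set in \<open>dual_width\<close> nonempty, so that its maximum
    \<open>g\<close> is attained.\<close>
  have "\<exists>i\<le>D. mat_vec (E i) v \<noteq> 0"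
  proof (rule ccontr)
    assume "\<not> ?thesis"
    then have "(\<Sum>i\<le>D. mat_vec (E i) v) = 0" by (intro sum.neutral) auto
    then show False using sum_E_mat_vec[of v] assms(5) by (simp add: zero_fun_def)
  qed
  then have "?W \<noteq> {}" by (auto simp: zero_fun_def)
  moreover have fin: "finite ?W" by simp
  ultimately have "g \<in> ?W" unfolding g_def dual_width_def by (intro Max_in)
  then have gD: "g \<le> D" by simp
  have above: "mat_vec (E h) v = 0" if "h \<le> D" "g + 1 \<le> h" for h
  proof (rule ccontr)
    assume "mat_vec (E h) v \<noteq> 0"
    then have "h \<le> g"
      using Max_ge[OF fin, of h] that(1) by (simp add: g_def dual_width_def zero_fun_def)
    then show False using that(2) by simp
  qed
  show "\<exists>y. v y \<noteq> 0 \<and> gdist R x y \<ge> D - dual_width R E v"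
  proof (rule ccontr)
    assume "\<not> ?thesis"
    \<comment> \<open>A violation at \<open>x\<close> confines the support to distances below
      \<open>D - g\<close>, while the components under \<open>E h\<close> vanish from
      \<open>g + 1\<close> on; these strict cut-offs sum to \<open>D + 1\<close>.\<close>
    then have near: "v y = 0" if "D - g \<le> d x y" for y using that unfolding g_def by blast
    have "v = 0"
    proof (rule lower_inter_eq_0[OF adjacency_system dual_adjacency_system])
      show "(D - g) + (g + 1) = D + 1" using gD by simp
      show "dual_proj x h v = 0" if "D - g \<le> h" for h
        using near that by (auto simp: dual_proj_def fun_eq_iff)
    qed (rule above)
    then show False using assms(5) by (simp add: zero_fun_def)
  qed
qed

end
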